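(* Let $D$ be any one of the following expressions, the exponents $a,b$ being fixed integers satisfying the indicated constraints: (i) $D(x,y)=d(T^a x,T^b y)$ with $a\ge 3$, $b\ge 0$; (ii) $D(x,y)=d(T^a x,T^b y)$ with $a\ge 0$, $b\ge 2$; (iii) $D(x,y)=d(T^a x,T^b x)$ with $a\ge 3$, $b\ge 0$, $a\neq b$; (iv) $D(x,y)=d(T^a y,T^b y)$ with $a\ge 2$, $b\ge 0$, $a\ne b$. Then, for each such choice of $D$, there exist a complete metric space $(X,d)$ and an operator $T\colon X\to X$ such that $T$ has no fixed points, while for some $q\in(0,1)$ the inequality \[ d(Tx,Ty)\le q\cdot\max\{d(x,y),\,d(Tx,x),\,d(Tx,y),\,d(Ty,x),\,d(Ty,y),\,d(T^2x,x),\,d(T^2x,y),\,d(T^2x,Tx),\,d(T^2x,Ty),\,D(x,y)\} \] holds for every $x,y\in X$.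
   Context: For a self-map $T\colon X\to X$ and an integer $k\ge 0$, $T^k$ denotes the $k$-th iterate of $T$ (with $T^0$ the identity), and $Tx$ means $T(x)$. The space $(X,d)$, the operator $T$ and the constant $q$ may depend on the choice of $D$ (its form and the exponents $a,b$), but $q$ does not depend on $x,y$. *)

theory Defs
  imports "HOL-Analysis.Analysis"
begin

text \<open>The additional expression D, as a function of the metric, the operator and two points.\<close>

type_synonym 'a metric_expr = "('a \<Rightarrow> 'a \<Rightarrow> real) \<Rightarrow> ('a \<Rightarrow> 'a) \<Rightarrow> 'a \<Rightarrow> 'a \<Rightarrow> real"

definition contractive_with ::
  "'a metric_expr \<Rightarrow> 'a set \<Rightarrow> ('a \<Rightarrow> 'a \<Rightarrow> real) \<Rightarrow> ('a \<Rightarrow> 'a) \<Rightarrow> real \<Rightarrow> bool"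
where
  "contractive_with D X d T q \<longleftrightarrow>
    (\<forall>x\<in>X. \<forall>y\<in>X.
      d (T x) (T y) \<le> q * Max {d x y, d (T x) x, d (T x) y, d (T y) x, d (T y) y,
        d ((T ^^ 2) x) x, d ((T ^^ 2) x) y, d ((T ^^ 2) x) (T x), d ((T ^^ 2) x) (T y),
        D d T x y})"

text \<open>
  Existence of a metric space has to be asserted over a fixed type of points. Taking subsets
  of the reals, with an arbitrary metric unrelated to the usual one, loses nothing: in any
  example, the smallest set that contains a given point and is closed both under T and
  topologically has at most the cardinality of the continuum and is again an example.
  Nonemptiness is required explicitly, since the empty set satisfies the remaining conditions
  vacuously.
\<close>

definition fixed_point_free_example :: "real metric_expr \<Rightarrow> bool"
where
  "fixed_point_free_example D \<longleftrightarrow>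
    (\<exists>(X :: real set) (d :: real \<Rightarrow> real \<Rightarrow> real) (T :: real \<Rightarrow> real).
      X \<noteq> {} \<and> Metric_space X d \<and> Metric_space.mcomplete X d \<and> T \<in> X \<rightarrow> X \<and>
      (\<forall>x\<in>X. T x \<noteq> x) \<and>
      (\<exists>q. 0 < q \<and> q < 1 \<and> contractive_with D X d T q))"

end

theory Submission
  imports Defs
begin

text \<open>
  Both examples are orbits on the real line: the powers of some integer \<open>c\<close> with \<open>T x = c * x\<close>.
  For \<open>x = c ^ m\<close> and \<open>y = c ^ n\<close> with \<open>m > n\<close> a term containing \<open>T\<^sup>2 x\<close> dominates.

  For \<open>c = -3\<close> the points jump back and forth across the origin, so \<open>d (T y) y\<close> dominates
  whenever \<open>n \<ge> m + 2\<close>. Only \<open>y = T x\<close> needs \<open>D\<close>, which there is the distance of two iterates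
  of \<open>x\<close>, at least one of order three or higher. This fails only if the two iterates coincide,
  i.e. if \<open>D x y = d (T\<^sup>b\<^sup>+\<^sup>1 x) (T\<^sup>b y)\<close> with \<open>b \<ge> 2\<close>.

  For that remaining \<open>D\<close>, take \<open>c = 2\<close>: now \<open>d (T y) x\<close> dominates when \<open>y = T x\<close>, and \<open>D\<close> itself
  when \<open>n \<ge> m + 2\<close>.
\<close>

lemma funpow_times: "(((*) c) ^^ k) x = c ^ k * x" for c x :: "'a::monoid_mult"
  by (induction k) (simp_all add: mult.assoc)

lemma mcomplete_dist_closed:
  fixes X :: "'a::complete_space set"
  assumes "closed X"
  shows "Metric_space.mcomplete X dist"
proof -
  interpret Submetric UNIV dist X
    by unfold_locales auto
  show ?thesis
    using closedin_eq_mcomplete assms by (simp add: complete_UNIV)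
qed

text \<open>As \<open>q\<close> is nonnegative, one dominating member of the set suffices; each case
  below can then name its own term.\<close>

lemma contractive_withI:
  assumes "\<And>x y. x \<in> X \<Longrightarrow> y \<in> X \<Longrightarrow> \<exists>t \<in> {d x y, d (T x) x, d (T x) y, d (T y) x, d (T y) y,
        d ((T ^^ 2) x) x, d ((T ^^ 2) x) y, d ((T ^^ 2) x) (T x), d ((T ^^ 2) x) (T y),
        D d T x y}. d (T x) (T y) \<le> q * t"
    and "0 \<le> q"
  shows "contractive_with D X d T q"
  unfolding contractive_with_def
proof (intro ballI)
  fix x y assume "x \<in> X" "y \<in> X"
  let ?S = "{d x y, d (T x) x, d (T x) y, d (T y) x, d (T y) y,
        d ((T ^^ 2) x) x, d ((T ^^ 2) x) y, d ((T ^^ 2) x) (T x), d ((T ^^ 2) x) (T y),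
        D d T x y}"
  obtain t where t: "t \<in> ?S" "d (T x) (T y) \<le> q * t"
    using assms(1)[OF \<open>x \<in> X\<close> \<open>y \<in> X\<close>] by blast
  have "t \<le> Max ?S"
    using t(1) by (intro Max_ge) auto
  with t(2) \<open>0 \<le> q\<close> show "d (T x) (T y) \<le> q * Max ?S"
    by (meson mult_left_mono order_trans)
qed

text \<open>A set of integers is closed in the real line, hence complete, and no power of
  \<open>c\<close> is 0, so \<open>c * x = x\<close> would force \<open>c = 1\<close>.\<close>

lemma fixed_point_free_example_powers:
  fixes c :: real
  assumes "c \<in> \<int>" "c \<noteq> 0" "c \<noteq> 1" "0 < q" "q < 1"
    and "contractive_with D (range ((^) c)) dist ((*) c) q"
  shows "fixed_point_free_example D"
proof -
  let ?X = "range ((^) c)"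
  have "?X \<subseteq> \<int>"
    using \<open>c \<in> \<int>\<close> by auto
  then have "Metric_space.mcomplete ?X dist"
    by (intro mcomplete_dist_closed closed_subset_Ints)
  moreover have "Metric_space ?X dist"
    by (simp add: Met_TC.subspace)
  moreover have "(*) c \<in> ?X \<rightarrow> ?X"
    by (auto simp flip: power_Suc)
  moreover have "\<forall>x \<in> ?X. c * x \<noteq> x"
    using \<open>c \<noteq> 0\<close> \<open>c \<noteq> 1\<close> by auto
  ultimately show ?thesis
    unfolding fixed_point_free_example_def using assms(4-6) by blast
qed

text \<open>Signs can be ignored: if \<open>i\<close> is the larger exponent, the absolute values
  differ by at least \<open>3 ^ i - 3 ^ (i - 1) = 2 * 3 ^ (i - 1)\<close>, and \<open>i - 1\<close>
  is at least 2.\<close>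

lemma dist_powers_minus_three:
  assumes "i \<noteq> j" "3 \<le> i \<or> 3 \<le> j"
  shows "18 \<le> \<bar>(- 3) ^ i - (- 3) ^ j :: real\<bar>"
proof -
  have *: "18 \<le> \<bar>(- 3) ^ i - (- 3) ^ j :: real\<bar>" if "j < i" "3 \<le> i" for i j :: nat
  proof -
    have "(3::real) ^ j \<le> 3 ^ (i - 1)" and "(3::real) ^ 2 \<le> 3 ^ (i - 1)"
      using that by (intro power_increasing; simp)+
    moreover have "(3::real) ^ 2 = 9"
      by simp
    moreover have "(3::real) ^ i = 3 * 3 ^ (i - 1)"
      using that by (simp flip: power_Suc)
    ultimately have "18 \<le> (3::real) ^ i - 3 ^ j"
      by linarith
    also have "\<dots> \<le> \<bar>(- 3) ^ i - (- 3) ^ j\<bar>"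
      using abs_triangle_ineq2[of "(- 3) ^ i :: real" "(- 3) ^ j"] by (simp add: power_abs)
    finally show ?thesis .
  qed
  show ?thesis
    using *[of i j] *[of j i] assms by (cases "i < j") (auto simp: abs_minus_commute)
qed

text \<open>\<open>D\<close> is constrained only at \<open>y = T x\<close>, the one case in which
  the other terms are not relied upon.\<close>

lemma contractive_with_powers_minus_three:
  assumes D: "\<And>x. D dist ((*) (- 3)) x (- 3 * x) =
      dist (((*) (- 3) ^^ i) x) (((*) (- 3) ^^ j) x)"
    and ij: "i \<noteq> j" "3 \<le> i \<or> 3 \<le> j"
  shows "contractive_with D (range ((^) (- 3))) dist ((*) (- 3 :: real)) (5 / 6)"
proof (rule contractive_withI)
  fix x y :: real assume "x \<in> range ((^) (- 3))" "y \<in> range ((^) (- 3))"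
  then obtain m n where x: "x = (- 3) ^ m" and y: "y = (- 3) ^ n"
    by auto
  have abs_eq: "\<bar>x\<bar> = 3 ^ m" "\<bar>y\<bar> = 3 ^ n"
    by (simp_all add: x y power_abs)
  have lhs: "dist (- 3 * x) (- 3 * y) \<le> 3 * (\<bar>x\<bar> + \<bar>y\<bar>)"
    by (simp add: dist_real_def)
  consider "m = n" | "n < m" | "n = Suc m" | "m + 2 \<le> n"
    by linarith
  then show "\<exists>t \<in> {dist x y, dist (- 3 * x) x, dist (- 3 * x) y, dist (- 3 * y) x,
      dist (- 3 * y) y, dist (((*) (- 3) ^^ 2) x) x, dist (((*) (- 3) ^^ 2) x) y,
      dist (((*) (- 3) ^^ 2) x) (- 3 * x), dist (((*) (- 3) ^^ 2) x) (- 3 * y),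
      D dist ((*) (- 3)) x y}. dist (- 3 * x) (- 3 * y) \<le> 5 / 6 * t"
  proof cases
    case 1
    then show ?thesis
      by (simp add: x y)
  next
    case 2
    then have "(3::real) ^ Suc n \<le> 3 ^ m"
      by (intro power_increasing) auto
    moreover have "dist (((*) (- 3) ^^ 2) x) x = 8 * \<bar>x\<bar>"
      by (simp add: funpow_times dist_real_def)
    ultimately have "dist (- 3 * x) (- 3 * y) \<le> 5 / 6 * dist (((*) (- 3) ^^ 2) x) x"
      using lhs abs_eq by simp
    then show ?thesis
      by blast
  next
    case 3
    then have yx: "y = - 3 * x"
      by (simp add: x y)
    have "D dist ((*) (- 3)) x y = \<bar>(- 3) ^ i - (- 3) ^ j\<bar> * \<bar>x\<bar>"
      unfolding yx D by (simp add: funpow_times dist_real_def flip: abs_mult left_diff_distrib)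
    then have "18 * \<bar>x\<bar> \<le> D dist ((*) (- 3)) x y"
      using dist_powers_minus_three[OF ij] by (simp add: mult_right_mono)
    moreover have "\<bar>y\<bar> = 3 * \<bar>x\<bar>"
      by (simp add: yx abs_mult)
    \<comment> \<open>The left side is at most \<open>12 * \<bar>x\<bar>\<close>, so the ratio is at
      most 2/3.\<close>
    ultimately have "dist (- 3 * x) (- 3 * y) \<le> 5 / 6 * D dist ((*) (- 3)) x y"
      using lhs by simp
    then show ?thesis
      by blast
  next
    case 4
    then have "(3::real) ^ (m + 2) \<le> 3 ^ n"
      by (intro power_increasing) auto
    moreover have "dist (- 3 * y) y = 4 * \<bar>y\<bar>"
      by (simp add: dist_real_def)
    \<comment> \<open>This case fixes the constant:
      \<open>9 * \<bar>x\<bar> \<le> \<bar>y\<bar>\<close> bounds the left side by 10/3 of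
      \<open>\<bar>y\<bar>\<close>, against \<open>4 * \<bar>y\<bar>\<close>.\<close>
    ultimately have "dist (- 3 * x) (- 3 * y) \<le> 5 / 6 * dist (- 3 * y) y"
      using lhs abs_eq by simp
    then show ?thesis
      by blast
  qed
qed simp

text \<open>The extra term equals \<open>2 ^ b * \<bar>2 * x - y\<bar>\<close>: it vanishes at
  \<open>y = T x\<close> but is large enough once \<open>y\<close> lies further along the
  orbit.\<close>

lemma contractive_with_powers_two:
  assumes "2 \<le> b"
  shows "contractive_with (\<lambda>d T x y. d ((T ^^ Suc b) x) ((T ^^ b) y))
    (range ((^) 2)) dist ((*) (2 :: real)) (3 / 4)"
proof (rule contractive_withI)
  fix x y :: real assume "x \<in> range ((^) 2)" "y \<in> range ((^) 2)"
  then obtain m n where x: "x = 2 ^ m" and y: "y = 2 ^ n"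
    by auto
  have pos: "x > 0" "y > 0"
    by (simp_all add: x y)
  consider "m = n" | "n < m" | "n = Suc m" | "m + 2 \<le> n"
    by linarith
  then show "\<exists>t \<in> {dist x y, dist (2 * x) x, dist (2 * x) y, dist (2 * y) x,
      dist (2 * y) y, dist (((*) 2 ^^ 2) x) x, dist (((*) 2 ^^ 2) x) y,
      dist (((*) 2 ^^ 2) x) (2 * x), dist (((*) 2 ^^ 2) x) (2 * y),
      dist (((*) 2 ^^ Suc b) x) (((*) 2 ^^ b) y)}. dist (2 * x) (2 * y) \<le> 3 / 4 * t"
  proof cases
    case 1
    then show ?thesis
      by (simp add: x y)
  next
    case 2
    then have "y \<le> x"
      unfolding x y by (intro power_increasing) auto
    then have "dist (2 * x) (2 * y) \<le> 3 / 4 * dist (((*) 2 ^^ 2) x) y"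
      using pos by (simp add: funpow_times dist_real_def)
    then show ?thesis
      by blast
  next
    case 3
    then have "y = 2 * x"
      by (simp add: x y)
    then have "dist (2 * x) (2 * y) \<le> 3 / 4 * dist (2 * y) x"
      using pos by (simp add: dist_real_def)
    then show ?thesis
      by blast
  next
    case 4
    then have "(2::real) ^ (m + 2) \<le> 2 ^ n"
      by (intro power_increasing) auto
    then have "4 * x \<le> y"
      by (simp add: x y)
    have "(2::real) ^ 2 \<le> 2 ^ b"
      using assms by (intro power_increasing) auto
    \<comment> \<open>Equivalent to \<open>4 * x \<le> y\<close>, with equality at
      \<open>y = 4 * x\<close>; hence the constant 3/4.\<close>
    have "dist (2 * x) (2 * y) \<le> 3 / 4 * (2 ^ 2 * (y - 2 * x))"
      using pos \<open>4 * x \<le> y\<close> by (simp add: dist_real_def)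
    also have "\<dots> \<le> 3 / 4 * (2 ^ b * (y - 2 * x))"
      using pos \<open>4 * x \<le> y\<close> \<open>2 ^ 2 \<le> 2 ^ b\<close> by (intro mult_left_mono mult_right_mono) auto
    also have "2 ^ b * (y - 2 * x) = \<bar>2 ^ b * (2 * x - y)\<bar>"
      using pos \<open>4 * x \<le> y\<close> by (simp add: abs_mult)
    also have "\<dots> = dist (((*) 2 ^^ Suc b) x) (((*) 2 ^^ b) y)"
      unfolding funpow_times dist_real_def by (simp add: algebra_simps)
    finally show ?thesis
      by blast
  qed
qed simp

theorem theorem1:
  fixes D :: "real metric_expr" and a b :: nat
  assumes "(D = (\<lambda>d T x y. d ((T ^^ a) x) ((T ^^ b) y)) \<and> a \<ge> 3 \<and> b \<ge> 0) \<or>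
           (D = (\<lambda>d T x y. d ((T ^^ a) x) ((T ^^ b) y)) \<and> a \<ge> 0 \<and> b \<ge> 2) \<or>
           (D = (\<lambda>d T x y. d ((T ^^ a) x) ((T ^^ b) x)) \<and> a \<ge> 3 \<and> b \<ge> 0 \<and> a \<noteq> b) \<or>
           (D = (\<lambda>d T x y. d ((T ^^ a) y) ((T ^^ b) y)) \<and> a \<ge> 2 \<and> b \<ge> 0 \<and> a \<noteq> b)"
  shows "fixed_point_free_example D"
proof (cases "D = (\<lambda>d T x y. d ((T ^^ a) x) ((T ^^ b) y)) \<and> a = Suc b \<and> 2 \<le> b")
  case True
  then have "contractive_with D (range ((^) 2)) dist ((*) 2) (3 / 4)"
    using contractive_with_powers_two by simp
  then show ?thesis
    by (rule fixed_point_free_example_powers[rotated -1]) auto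
next
  case False
  \<comment> \<open>At \<open>y = T x\<close> an iterate of \<open>y\<close> is the next iterate of
    \<open>x\<close>, so exponents attached to \<open>y\<close> rise by one.\<close>
  have "\<exists>i j. (\<forall>x. D dist ((*) (- 3)) x (- 3 * x) =
      dist (((*) (- 3) ^^ i) x) (((*) (- 3) ^^ j) x)) \<and> i \<noteq> j \<and> (3 \<le> i \<or> 3 \<le> j)"
    using assms
  proof (elim disjE conjE)
    assume "D = (\<lambda>d T x y. d ((T ^^ a) x) ((T ^^ b) y))" "3 \<le> a"
    then show ?thesis
      \<comment> \<open>If \<open>a = Suc b\<close>, then \<open>3 \<le> a\<close> gives
        \<open>2 \<le> b\<close>, the case already settled.\<close>
      using False by (intro exI[of _ a] exI[of _ "Suc b"]) (auto simp: funpow_Suc_right simp del: funpow.simps)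
  next
    assume "D = (\<lambda>d T x y. d ((T ^^ a) x) ((T ^^ b) y))" "2 \<le> b"
    then show ?thesis
      using False by (intro exI[of _ a] exI[of _ "Suc b"]) (auto simp: funpow_Suc_right simp del: funpow.simps)
  next
    assume "D = (\<lambda>d T x y. d ((T ^^ a) x) ((T ^^ b) x))" "3 \<le> a" "a \<noteq> b"
    then show ?thesis
      by blast
  next
    assume "D = (\<lambda>d T x y. d ((T ^^ a) y) ((T ^^ b) y))" "2 \<le> a" "a \<noteq> b"
    then show ?thesis
      by (intro exI[of _ "Suc a"] exI[of _ "Suc b"]) (auto simp: funpow_Suc_right simp del: funpow.simps)
  qed
  then obtain i j where
    "\<And>x. D dist ((*) (- 3)) x (- 3 * x) = dist (((*) (- 3) ^^ i) x) (((*) (- 3) ^^ j) x)"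
    "i \<noteq> j" "3 \<le> i \<or> 3 \<le> j"
    by blast
  then have "contractive_with D (range ((^) (- 3))) dist ((*) (- 3)) (5 / 6)"
    by (rule contractive_with_powers_minus_three)
  then show ?thesis
    by (rule fixed_point_free_example_powers[rotated -1]) auto
qed

end
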